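(* Let $\mathbf{X}$ be a three-valued scheme. Then $\vDash^{st}_{\mathbf{X}} \ =\ \vDash_2$ if and only if $\mathbf{X}$ is Boolean normal and, in addition, either monotonic or collapsible (i.e. truth-collapsible or falsity-collapsible).
   Context: Language: $P$ is a denumerable (countably infinite) set of propositional variables, and $\mathcal{L}$ is the set of formulae generated from $P$ by the connectives $\neg$ (unary), $\wedge$, $\vee$ (binary). $\Gamma,\Delta$ range over arbitrary sets of formulae; a consequence relation is a set of pairs $(\Gamma,\Delta)$. Classical consequence $\vDash_2$: $\Gamma\vDash_2\Delta$ iff for every $v:\mathcal{L}\to\{0,1\}$ with $v(\neg A)=1-v(A)$, $v(A\wedge B)=\min(v(A),v(B))$, $v(A\vee B)=\max(v(A),v(B))$: if $v(A)=1$ for every $A\in\Gamma$, then $v(B)=1$ for some $B\in\Delta$. A three-valued scheme is a triple $\mathbf{X}=(f_\neg,f_\wedge,f_\vee)$ of operations on $\{1,\tfrac12,0\}$ (of arity $1,2,2$). An $\mathbf{X}$-valuation is a map $v:\mathcal{L}\to\{1,\tfrac12,0\}$ with $v(\neg A)=f_\neg(v(A))$, $v(A\wedge B)=f_\wedge(v(A),v(B))$, $v(A\vee B)=f_\vee(v(A),v(B))$. $\Gamma\vDash^{st}_{\mathbf{X}}\Delta$ iff for every $\mathbf{X}$-valuation $v$: if $v(A)=1$ for every $A\in\Gamma$, then $v(B)\in\{1,\tfrac12\}$ for some $B\in\Delta$. Boolean normality: $\mathbf{X}$ is Boolean normal iff for all $x,y\in\{0,1\}$: $f_\neg(x)=1-x$,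 $f_\wedge(x,y)=\min(x,y)$, $f_\vee(x,y)=\max(x,y)$. Monotonicity: let $\leq_{\rm I}$ be the partial order on $\{1,\tfrac12,0\}$ whose only strict relations are $\tfrac12<_{\rm I}0$ and $\tfrac12<_{\rm I}1$. An $n$-ary operation $\star$ is monotonic iff $\star(a_1,\dots,a_n)\leq_{\rm I}\star(b_1,\dots,b_n)$ whenever $a_j\leq_{\rm I}b_j$ for all $1\le j\le n$. $\mathbf{X}$ is monotonic iff each of $f_\neg,f_\wedge,f_\vee$ is. Collapsibility: for $\alpha\in\{0,1\}$ let $\tau_\alpha:\{1,\tfrac12,0\}\to\{0,1\}$ be given by $\tau_\alpha(0)=0$, $\tau_\alpha(1)=1$, $\tau_\alpha(\tfrac12)=\alpha$. $\mathbf{X}$ is $\alpha$-collapsible iff for all $x,y\in\{1,\tfrac12,0\}$: $\tau_\alpha(f_\neg(x))=1-\tau_\alpha(x)$, $\tau_\alpha(f_\wedge(x,y))=\min(\tau_\alpha(x),\tau_\alpha(y))$, and $\tau_\alpha(f_\vee(x,y))=\max(\tau_\alpha(x),\tau_\alpha(y))$. Truth-collapsible means $1$-collapsible; falsity-collapsible means $0$-collapsible; collapsible means truth-collapsible or falsity-collapsible (the same $\alpha$ for all three operations). *)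

theory Defs
  imports Main "HOL-Library.Countable" "HOL-Library.Infinite_Typeclass"
begin

(* The type parameter is the set of propositional variables; it is taken to be of sort
   {countable, infinite}, i.e. denumerable, wherever that matters. *)
datatype 'p fm =
    Var 'p
  | Neg "'p fm"
  | Conj "'p fm" "'p fm"
  | Disj "'p fm" "'p fm"

type_synonym 'p consequence = "('p fm set \<times> 'p fm set) set"

(* The set {0,1} of classical values is rendered by bool, on which 1 - x, min and max
   are \<not>, \<and> and \<or>. *)
definition classical_valuation :: "('p fm \<Rightarrow> bool) \<Rightarrow> bool" where
  "classical_valuation v \<longleftrightarrow>
     (\<forall>A. v (Neg A) \<longleftrightarrow> \<not> v A) \<and>
     (\<forall>A B. v (Conj A B) \<longleftrightarrow> v A \<and> v B) \<and>
     (\<forall>A B. v (Disj A B) \<longleftrightarrow> v A \<or> v B)"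

definition classical_consequence :: "'p consequence" where
  "classical_consequence =
     {(\<Gamma>, \<Delta>). \<forall>v. classical_valuation v \<longrightarrow> (\<forall>A\<in>\<Gamma>. v A) \<longrightarrow> (\<exists>B\<in>\<Delta>. v B)}"

(* The values 1, 1/2 and 0. *)
datatype tv = One | Half | Zero

record scheme =
  f_neg  :: "tv \<Rightarrow> tv"
  f_conj :: "tv \<Rightarrow> tv \<Rightarrow> tv"
  f_disj :: "tv \<Rightarrow> tv \<Rightarrow> tv"

definition valuation :: "scheme \<Rightarrow> ('p fm \<Rightarrow> tv) \<Rightarrow> bool" where
  "valuation X v \<longleftrightarrow>
     (\<forall>A. v (Neg A) = f_neg X (v A)) \<and>
     (\<forall>A B. v (Conj A B) = f_conj X (v A) (v B)) \<and>
     (\<forall>A B. v (Disj A B) = f_disj X (v A) (v B))"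

definition st_consequence :: "scheme \<Rightarrow> 'p consequence" where
  "st_consequence X =
     {(\<Gamma>, \<Delta>). \<forall>v. valuation X v \<longrightarrow> (\<forall>A\<in>\<Gamma>. v A = One) \<longrightarrow> (\<exists>B\<in>\<Delta>. v B \<in> {One, Half})}"

(* The inclusion of {0,1} into {1, 1/2, 0}. *)
definition tv_of_bool :: "bool \<Rightarrow> tv" where
  "tv_of_bool b = (if b then One else Zero)"

definition boolean_normal :: "scheme \<Rightarrow> bool" where
  "boolean_normal X \<longleftrightarrow>
     (\<forall>x y. f_neg X (tv_of_bool x) = tv_of_bool (\<not> x) \<and>
            f_conj X (tv_of_bool x) (tv_of_bool y) = tv_of_bool (x \<and> y) \<and>
            f_disj X (tv_of_bool x) (tv_of_bool y) = tv_of_bool (x \<or> y))"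

definition le_I :: "tv \<Rightarrow> tv \<Rightarrow> bool" (infix "\<le>\<^sub>I" 50) where
  "x \<le>\<^sub>I y \<longleftrightarrow> x = y \<or> x = Half \<and> y = Zero \<or> x = Half \<and> y = One"

definition monotonic1 :: "(tv \<Rightarrow> tv) \<Rightarrow> bool" where
  "monotonic1 f \<longleftrightarrow> (\<forall>a b. a \<le>\<^sub>I b \<longrightarrow> f a \<le>\<^sub>I f b)"

definition monotonic2 :: "(tv \<Rightarrow> tv \<Rightarrow> tv) \<Rightarrow> bool" where
  "monotonic2 f \<longleftrightarrow>
     (\<forall>a1 a2 b1 b2. a1 \<le>\<^sub>I b1 \<longrightarrow> a2 \<le>\<^sub>I b2 \<longrightarrow> f a1 a2 \<le>\<^sub>I f b1 b2)"

definition monotonic :: "scheme \<Rightarrow> bool" where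
  "monotonic X \<longleftrightarrow> monotonic1 (f_neg X) \<and> monotonic2 (f_conj X) \<and> monotonic2 (f_disj X)"

fun collapse :: "bool \<Rightarrow> tv \<Rightarrow> bool" where
  "collapse \<alpha> Zero = False"
| "collapse \<alpha> One = True"
| "collapse \<alpha> Half = \<alpha>"

definition collapsible_to :: "bool \<Rightarrow> scheme \<Rightarrow> bool" where
  "collapsible_to \<alpha> X \<longleftrightarrow>
     (\<forall>x y. (collapse \<alpha> (f_neg X x) \<longleftrightarrow> \<not> collapse \<alpha> x) \<and>
            (collapse \<alpha> (f_conj X x y) \<longleftrightarrow> collapse \<alpha> x \<and> collapse \<alpha> y) \<and>
            (collapse \<alpha> (f_disj X x y) \<longleftrightarrow> collapse \<alpha> x \<or> collapse \<alpha> y))"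

definition truth_collapsible :: "scheme \<Rightarrow> bool" where
  "truth_collapsible X \<longleftrightarrow> collapsible_to True X"

definition falsity_collapsible :: "scheme \<Rightarrow> bool" where
  "falsity_collapsible X \<longleftrightarrow> collapsible_to False X"

definition collapsible :: "scheme \<Rightarrow> bool" where
  "collapsible X \<longleftrightarrow> truth_collapsible X \<or> falsity_collapsible X"

end

theory Submission
  imports Defs
begin

text \<open>
  Say that a classical valuation \<open>w\<close> \<^emph>\<open>refines\<close> an \<open>X\<close>-valuation \<open>v\<close> if it agrees with \<open>v\<close> wherever
  \<open>v\<close> takes a classical value. A countermodel for strict-tolerant consequence makes all premises
  1 and all conclusions 0, so it uses classical values only, and both inclusions between the two
  consequence relations become statements about refinement. Every classical valuation is, up to
  the inclusion of \<open>{0,1}\<close>, itself an \<open>X\<close>-valuation just in case \<open>X\<close> is Boolean normal, and this is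
  the inclusion of strict-tolerant in classical consequence
  (\<open>st_subset_classical_iff_boolean_normal\<close>). Every \<open>X\<close>-valuation has a classical refinement just
  in case the converse inclusion holds (\<open>classical_subset_st_iff_refinable\<close>). Arbitrary
  sets of premises and conclusions are admitted, so each equivalence is obtained by describing a
  single valuation completely by one inference.

  It remains to see when all \<open>X\<close>-valuations are refinable, for a Boolean normal \<open>X\<close>. If \<open>X\<close> is
  monotonic, turn every variable of value 1/2 into a classical one at will; if \<open>X\<close> is collapsible
  to \<open>\<alpha>\<close>, read 1/2 as \<open>\<alpha>\<close> throughout. Conversely, take an \<open>X\<close>-valuation \<open>v\<close> whose variables already
  take all three values, and let \<open>w\<close> refine it. As \<open>A\<close> ranges over the formulae, the pairs
  \<open>(v A, w A)\<close> form a subalgebra of the product of \<open>X\<close> with the two-element Boolean algebra,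
  contained in the set of the four pairs \<open>(1,1)\<close>, \<open>(0,0)\<close>, \<open>(1/2,1)\<close>, \<open>(1/2,0)\<close>. If only one of the
  last two occurs, the subalgebra is the graph of a collapse map, which is therefore a
  homomorphism. If both occur, the relation \<open>x \<le>\<^sub>I b\<close> between three-valued \<open>x\<close> and classical \<open>b\<close> is
  preserved by the operations, and with Boolean normality this gives monotonicity
  (\<open>refinable_imp_monotonic_or_collapsible\<close>).
\<close>

section \<open>Valuations and their refinements\<close>

primrec extend :: "('a \<Rightarrow> 'a) \<Rightarrow> ('a \<Rightarrow> 'a \<Rightarrow> 'a) \<Rightarrow> ('a \<Rightarrow> 'a \<Rightarrow> 'a) \<Rightarrow> ('p \<Rightarrow> 'a) \<Rightarrow> 'p fm \<Rightarrow> 'a" where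
  "extend n c d f (Var p) = f p"
| "extend n c d f (Neg A) = n (extend n c d f A)"
| "extend n c d f (Conj A B) = c (extend n c d f A) (extend n c d f B)"
| "extend n c d f (Disj A B) = d (extend n c d f A) (extend n c d f B)"

lemma valuation_extend: "valuation X (extend (f_neg X) (f_conj X) (f_disj X) f)"
  by (simp add: valuation_def)

lemma classical_valuation_extend: "classical_valuation (extend Not (\<and>) (\<or>) f)"
  by (simp add: classical_valuation_def)

definition refines :: "('p fm \<Rightarrow> bool) \<Rightarrow> ('p fm \<Rightarrow> tv) \<Rightarrow> bool" where
  "refines w v \<longleftrightarrow> (\<forall>A. v A \<le>\<^sub>I tv_of_bool (w A))"

lemma tv_of_bool_simps [simp]: "tv_of_bool True = One" "tv_of_bool False = Zero"
  by (simp_all add: tv_of_bool_def)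

lemma le_I_tv_of_bool_iff:
  "x \<le>\<^sub>I tv_of_bool b \<longleftrightarrow> (x = One \<longrightarrow> b) \<and> (x = Zero \<longrightarrow> \<not> b)"
  by (cases x; cases b) (auto simp: le_I_def)

section \<open>The two inclusions in terms of valuations\<close>

text \<open>For the nontrivial direction apply the inclusion to the pair consisting of the formulae with
  value 1 and those with value 0: a classical countermodel to it is a refinement.\<close>

lemma classical_subset_st_iff_refinable:
  "(classical_consequence :: 'p consequence) \<subseteq> st_consequence X \<longleftrightarrow>
     (\<forall>v :: 'p fm \<Rightarrow> tv. valuation X v \<longrightarrow> (\<exists>w. classical_valuation w \<and> refines w v))"
proof (intro iffI allI impI)
  fix v :: "'p fm \<Rightarrow> tv"
  assume sub: "(classical_consequence :: 'p consequence) \<subseteq> st_consequence X" and v: "valuation X v"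
  have "({A. v A = One}, {A. v A = Zero}) \<notin> st_consequence X"
    using v by (auto simp: st_consequence_def)
  then have "({A. v A = One}, {A. v A = Zero}) \<notin> classical_consequence"
    using sub by blast
  then show "\<exists>w. classical_valuation w \<and> refines w v"
    by (auto simp: classical_consequence_def refines_def le_I_tv_of_bool_iff)
next
  assume ref: "\<forall>v :: 'p fm \<Rightarrow> tv. valuation X v \<longrightarrow> (\<exists>w. classical_valuation w \<and> refines w v)"
  show "(classical_consequence :: 'p consequence) \<subseteq> st_consequence X"
  proof (clarsimp simp: st_consequence_def)
    fix \<Gamma> \<Delta> and v :: "'p fm \<Rightarrow> tv"
    assume cl: "(\<Gamma>, \<Delta>) \<in> classical_consequence" and v: "valuation X v"
      and prem: "\<forall>A\<in>\<Gamma>. v A = One"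
    obtain w where w: "classical_valuation w" "refines w v"
      using ref v by blast
    have "\<forall>A\<in>\<Gamma>. w A"
      using w(2) prem by (auto simp: refines_def le_I_tv_of_bool_iff)
    then obtain B where "B \<in> \<Delta>" "w B"
      using cl w(1) by (auto simp: classical_consequence_def)
    then show "\<exists>B\<in>\<Delta>. v B = One \<or> v B = Half"
      using w(2) by (metis refines_def le_I_tv_of_bool_iff tv.exhaust)
  qed
qed

text \<open>A classical valuation \<open>w\<close> refutes the inference from the formulae it verifies to those it
  falsifies. An \<open>X\<close>-countermodel to that inference can only be \<open>w\<close> itself, so \<open>w\<close> commutes with the
  operations of \<open>X\<close>. Two distinct variables then realise all pairs of classical arguments.\<close>

lemma st_subset_classical_iff_boolean_normal:
  "(st_consequence X :: 'p::infinite consequence) \<subseteq> classical_consequence \<longleftrightarrow> boolean_normal X"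
proof
  assume sub: "(st_consequence X :: 'p consequence) \<subseteq> classical_consequence"
  obtain p q :: 'p where pq: "p \<noteq> q"
    using ex_new_if_finite[OF infinite_UNIV, of "{undefined}"] by blast
  show "boolean_normal X"
    unfolding boolean_normal_def
  proof (intro allI)
    fix x y
    define w :: "'p fm \<Rightarrow> bool" where "w = extend Not (\<and>) (\<or>) (\<lambda>r. if r = p then x else y)"
    have "({A. w A}, {A. \<not> w A}) \<notin> classical_consequence"
      using classical_valuation_extend by (auto simp: classical_consequence_def w_def)
    then have "({A. w A}, {A. \<not> w A}) \<notin> st_consequence X"
      using sub by blast
    then obtain v where v: "valuation X v" "\<And>A. w A \<Longrightarrow> v A = One"
      and neg: "\<And>A. \<not> w A \<Longrightarrow> v A \<notin> {One, Half}"
      by (auto simp: st_consequence_def)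
    have vw: "v A = tv_of_bool (w A)" for A
      using v(2)[of A] neg[of A] by (cases "v A"; cases "w A") auto
    have hom: "f_neg X (tv_of_bool (w A)) = tv_of_bool (w (Neg A))"
        "f_conj X (tv_of_bool (w A)) (tv_of_bool (w B)) = tv_of_bool (w (Conj A B))"
        "f_disj X (tv_of_bool (w A)) (tv_of_bool (w B)) = tv_of_bool (w (Disj A B))" for A B
      using v(1) unfolding vw[symmetric] by (simp_all add: valuation_def)
    show "f_neg X (tv_of_bool x) = tv_of_bool (\<not> x) \<and>
        f_conj X (tv_of_bool x) (tv_of_bool y) = tv_of_bool (x \<and> y) \<and>
        f_disj X (tv_of_bool x) (tv_of_bool y) = tv_of_bool (x \<or> y)"
      using hom(1)[of "Var p"] hom(2,3)[of "Var p" "Var q"] pq by (simp add: w_def)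
  qed
next
  assume bn: "boolean_normal X"
  show "(st_consequence X :: 'p consequence) \<subseteq> classical_consequence"
  proof (clarsimp simp: classical_consequence_def)
    fix \<Gamma> \<Delta> and w :: "'p fm \<Rightarrow> bool"
    assume st: "(\<Gamma>, \<Delta>) \<in> st_consequence X" and w: "classical_valuation w"
      and prem: "\<forall>A\<in>\<Gamma>. w A"
    have "valuation X (\<lambda>A. tv_of_bool (w A))"
      using bn w by (simp add: valuation_def boolean_normal_def classical_valuation_def)
    then have "\<exists>B\<in>\<Delta>. tv_of_bool (w B) \<in> {One, Half}"
      using st prem by (fastforce simp: st_consequence_def)
    then show "\<exists>B\<in>\<Delta>. w B"
      by (auto simp: tv_of_bool_def split: if_splits)
  qed
qed

section \<open>Refinability, monotonicity and collapsibility\<close>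

lemma monotonic_imp_refinable:
  assumes bn: "boolean_normal X" and mono: "monotonic X" and v: "valuation X v"
  shows "\<exists>w. classical_valuation w \<and> refines w v"
proof -
  \<comment> \<open>Variables of value 1/2 become false; either choice would do.\<close>
  define w where "w = extend Not (\<and>) (\<or>) (\<lambda>p. v (Var p) = One)"
  have "v A \<le>\<^sub>I tv_of_bool (w A)" for A
  proof (induction A)
    case (Var p)
    show ?case by (simp add: w_def le_I_tv_of_bool_iff)
  next
    case (Neg A)
    then have "f_neg X (v A) \<le>\<^sub>I f_neg X (tv_of_bool (w A))"
      using mono by (simp add: monotonic_def monotonic1_def)
    then show ?case
      using v bn by (simp add: w_def valuation_def boolean_normal_def)
  next
    case (Conj A B)
    then have "f_conj X (v A) (v B) \<le>\<^sub>I f_conj X (tv_of_bool (w A)) (tv_of_bool (w B))"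
      using mono by (simp add: monotonic_def monotonic2_def)
    then show ?case
      using v bn by (simp add: w_def valuation_def boolean_normal_def)
  next
    case (Disj A B)
    then have "f_disj X (v A) (v B) \<le>\<^sub>I f_disj X (tv_of_bool (w A)) (tv_of_bool (w B))"
      using mono by (simp add: monotonic_def monotonic2_def)
    then show ?case
      using v bn by (simp add: w_def valuation_def boolean_normal_def)
  qed
  then show ?thesis
    using classical_valuation_extend unfolding refines_def w_def by blast
qed

lemma collapsible_to_imp_refinable:
  assumes "collapsible_to \<alpha> X" and "valuation X v"
  shows "\<exists>w. classical_valuation w \<and> refines w v"
proof (intro exI conjI)
  show "classical_valuation (\<lambda>A. collapse \<alpha> (v A))"
    using assms by (simp add: collapsible_to_def valuation_def classical_valuation_def)
  show "refines (\<lambda>A. collapse \<alpha> (v A)) v"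
    by (simp add: refines_def le_I_tv_of_bool_iff)
qed

lemma collapsible_iff: "collapsible X \<longleftrightarrow> (\<exists>\<alpha>. collapsible_to \<alpha> X)"
  unfolding collapsible_def truth_collapsible_def falsity_collapsible_def by (metis (full_types))

text \<open>Comparisons with a value at classical arguments are exactly the hypothesis. In the others some
  upper argument is \<open>1/2\<close>, so that the lower one in the same place is \<open>1/2\<close> too; unless nothing
  changes at all, the lower arguments are both \<open>1/2\<close>. But \<open>f Half Half\<close> lies below both classical
  values, as \<open>g\<close> is not constant, and hence is the least value.\<close>

lemma monotonic2_if_classical_bounds:
  assumes bound: "\<And>x y b c. x \<le>\<^sub>I tv_of_bool b \<Longrightarrow> y \<le>\<^sub>I tv_of_bool c \<Longrightarrow>
                   f x y \<le>\<^sub>I tv_of_bool (g b c)"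
    and classical: "\<And>b c. f (tv_of_bool b) (tv_of_bool c) = tv_of_bool (g b c)"
    and g: "g True True" "\<not> g False False"
  shows "monotonic2 f"
  unfolding monotonic2_def
proof (intro allI impI)
  fix a1 a2 b1 b2
  assume le: "a1 \<le>\<^sub>I b1" "a2 \<le>\<^sub>I b2"
  have "f Half Half \<le>\<^sub>I One" "f Half Half \<le>\<^sub>I Zero"
    using bound[of Half True Half True] bound[of Half False Half False] g
    by (simp_all add: le_I_def)
  then have bot: "f Half Half \<le>\<^sub>I x" for x
    by (cases x) (auto simp: le_I_def)
  consider "b1 = Half \<or> b2 = Half" | b c where "b1 = tv_of_bool b" "b2 = tv_of_bool c"
    by (metis tv.exhaust tv_of_bool_simps)
  then show "f a1 a2 \<le>\<^sub>I f b1 b2"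
  proof cases
    case 1
    then have "a1 = b1 \<and> a2 = b2 \<or> a1 = Half \<and> a2 = Half"
      using le by (auto simp: le_I_def)
    then show ?thesis
      using bot by (auto simp: le_I_def)
  next
    case 2
    then show ?thesis
      using bound classical le by metis
  qed
qed

lemma monotonic1_if_classical_bounds:
  assumes bound: "\<And>x b. x \<le>\<^sub>I tv_of_bool b \<Longrightarrow> f x \<le>\<^sub>I tv_of_bool (g b)"
    and classical: "\<And>b. f (tv_of_bool b) = tv_of_bool (g b)"
  shows "monotonic1 f"
  unfolding monotonic1_def
proof (intro allI impI)
  fix a b
  assume le: "a \<le>\<^sub>I b"
  show "f a \<le>\<^sub>I f b"
  proof (cases "b = Half")
    case True
    then show ?thesis using le by (simp add: le_I_def)
  next
    case False
    then obtain c where "b = tv_of_bool c"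
      by (metis tv.exhaust tv_of_bool_simps)
    then show ?thesis
      using bound classical le by metis
  qed
qed

text \<open>The valuation \<open>v\<close> takes all three values on variables, so that every argument of an operation
  is the value of some formula. The case distinction is whether the refinement \<open>w\<close> treats all
  formulae of value \<open>1/2\<close> alike.\<close>

lemma refinable_imp_monotonic_or_collapsible:
  assumes bn: "boolean_normal X"
    and ref: "\<And>v :: 'p::infinite fm \<Rightarrow> tv. valuation X v \<Longrightarrow> \<exists>w. classical_valuation w \<and> refines w v"
  shows "monotonic X \<or> collapsible X"
proof -
  obtain p :: 'p where "True" by blast
  obtain q :: 'p where q: "q \<noteq> p"
    using ex_new_if_finite[OF infinite_UNIV, of "{p}"] by blast
  obtain r :: 'p where r: "r \<notin> {p, q}"
    using ex_new_if_finite[OF infinite_UNIV, of "{p, q}"] by blast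
  define v :: "'p fm \<Rightarrow> tv" where
    "v = extend (f_neg X) (f_conj X) (f_disj X)
           (\<lambda>s. if s = p then One else if s = q then Zero else Half)"
  have v: "v (Neg A) = f_neg X (v A)" "v (Conj A B) = f_conj X (v A) (v B)"
    "v (Disj A B) = f_disj X (v A) (v B)" for A B
    by (simp_all add: v_def)
  have vars: "v (Var p) = One" "v (Var q) = Zero" "v (Var r) = Half"
    using q r by (auto simp: v_def)
  obtain w where "classical_valuation w" and refw: "refines w v"
    using ref valuation_extend unfolding v_def by blast
  then have w: "w (Neg A) \<longleftrightarrow> \<not> w A" "w (Conj A B) \<longleftrightarrow> w A \<and> w B" "w (Disj A B) \<longleftrightarrow> w A \<or> w B"
    for A B
    by (auto simp: classical_valuation_def)
  have le: "v A \<le>\<^sub>I tv_of_bool (w A)" for A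
    using refw by (simp add: refines_def)
  show ?thesis
  proof (cases "\<exists>A B. v A = Half \<and> w A \<and> v B = Half \<and> \<not> w B")
    case True
    have real: "\<exists>A. v A = x \<and> w A = b" if "x \<le>\<^sub>I tv_of_bool b" for x b
    proof (cases "x = Half")
      case False
      then show ?thesis
        using that vars le[of "Var p"] le[of "Var q"]
        by (cases x) (auto simp: le_I_tv_of_bool_iff)
    qed (use True in \<open>cases b; blast\<close>)
    have conn: "f_neg X x \<le>\<^sub>I tv_of_bool (\<not> b)" "f_conj X x y \<le>\<^sub>I tv_of_bool (b \<and> c)"
        "f_disj X x y \<le>\<^sub>I tv_of_bool (b \<or> c)"
      if args: "x \<le>\<^sub>I tv_of_bool b" "y \<le>\<^sub>I tv_of_bool c" for x y b c
    proof -
      obtain A B where "v A = x" "w A = b" "v B = y" "w B = c"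
        using real[OF args(1)] real[OF args(2)] by blast
      then show "f_neg X x \<le>\<^sub>I tv_of_bool (\<not> b)" "f_conj X x y \<le>\<^sub>I tv_of_bool (b \<and> c)"
          "f_disj X x y \<le>\<^sub>I tv_of_bool (b \<or> c)"
        using le[of "Neg A"] le[of "Conj A B"] le[of "Disj A B"] by (simp_all add: v w)
    qed
    have "monotonic1 (f_neg X)"
      using conn(1) bn by (intro monotonic1_if_classical_bounds) (auto simp: boolean_normal_def)
    moreover have "monotonic2 (f_conj X)"
      using conn(2) bn
      by (intro monotonic2_if_classical_bounds[where g = "(\<and>)"]) (auto simp: boolean_normal_def)
    moreover have "monotonic2 (f_disj X)"
      using conn(3) bn
      by (intro monotonic2_if_classical_bounds[where g = "(\<or>)"]) (auto simp: boolean_normal_def)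
    ultimately have "monotonic X"
      by (simp add: monotonic_def)
    then show ?thesis ..
  next
    case False
    define \<alpha> where "\<alpha> = w (Var r)"
    have col: "collapse \<alpha> (v A) = w A" for A
      using False vars(3) le[of A] unfolding \<alpha>_def
      by (cases "v A") (auto simp: le_I_tv_of_bool_iff)
    have surj: "\<exists>A. v A = x" for x
      using vars by (cases x) blast+
    have "collapsible_to \<alpha> X"
      unfolding collapsible_to_def
    proof (intro allI)
      fix x y
      obtain A B where "x = v A" "y = v B"
        using surj by metis
      then show "(collapse \<alpha> (f_neg X x) \<longleftrightarrow> \<not> collapse \<alpha> x) \<and>
          (collapse \<alpha> (f_conj X x y) \<longleftrightarrow> collapse \<alpha> x \<and> collapse \<alpha> y) \<and>
          (collapse \<alpha> (f_disj X x y) \<longleftrightarrow> collapse \<alpha> x \<or> collapse \<alpha> y)"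
        by (simp add: v[symmetric] col w)
    qed
    then show ?thesis
      using collapsible_iff by blast
  qed
qed

theorem theorem3p5:
  fixes X :: scheme
  shows "(st_consequence X :: 'p::{countable,infinite} consequence) = classical_consequence \<longleftrightarrow>
         boolean_normal X \<and> (monotonic X \<or> collapsible X)"
proof -
  have "(classical_consequence :: 'p consequence) \<subseteq> st_consequence X \<longleftrightarrow> monotonic X \<or> collapsible X"
    if "boolean_normal X"
    unfolding classical_subset_st_iff_refinable collapsible_iff
    using refinable_imp_monotonic_or_collapsible[where 'p = 'p, OF that] collapsible_iff
      monotonic_imp_refinable[OF that] collapsible_to_imp_refinable
    by metis
  then show ?thesis
    using st_subset_classical_iff_boolean_normal[where 'p = 'p and X = X] by auto
qed

end
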